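(* Let $X$ be a real separable Hilbert space with dual $X^*$. Assume the following. 1) $J:X\to[0,+\infty]$ is a proper lower semicontinuous convex functional with $J(0_X)=0$. 2) $a_0:X\times X\to\mathbb R$ is a bilinear form such that $|a_0(u,v)|\le K\|u\|_X\|v\|_X$ for all $u,v\in X$, and for some $\alpha>0$, $a_0(u,u)\ge\alpha\|u\|_X^2$ for all $u\in X$. 3) $a_1:X\times X\times X\to\mathbb R$ is a trilinear functional such that $|a_1(w,u,v)|\le K\|w\|_X\|u\|_X\|v\|_X$ for all $w,u,v\in X$. If $f\in X^*$ is small enough (that is, there is $\eta>0$ such that the following holds whenever $\|f\|_{X^*}\le\eta$), then there is $M\ge0$ satisfying $$M=\frac1\alpha\left(\|f\|_{X^*}+KM^2\right),\qquad \frac{2KM}{\alpha}<1,$$ and for this $M$ there exists in $\mathscr O_M(0_X)=\{v\in X:\|v\|_X\le M\}$ a unique solution $v$ to the variational inequality $$a_0(v,u-v)+a_1(v,v,u-v)+J(u)-J(v)\ge\langle f,u-v\rangle\quad\forall u\in X.$$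
   Context: A functional $J:X\to\mathbb R\cup\{+\infty\}$ is proper if it is not identically $+\infty$. $\langle\cdot,\cdot\rangle$ is the duality pairing between $X^*$ and $X$. $0_X$ is the zero element of $X$. A solution $v$ of the variational inequality is understood to satisfy $J(v)<+\infty$. *)

theory Defs
  imports "HOL-Analysis.Analysis"
begin

definition proper_functional :: "('a \<Rightarrow> ereal) \<Rightarrow> bool" where
  "proper_functional J \<longleftrightarrow> (\<forall>x. J x \<noteq> -\<infinity>) \<and> (\<exists>x. J x \<noteq> \<infinity>)"

definition lower_semicontinuous :: "('a::topological_space \<Rightarrow> ereal) \<Rightarrow> bool" where
  "lower_semicontinuous J \<longleftrightarrow> (\<forall>x. J x \<le> Liminf (at x) J)"

text \<open>The library's \<^const>\<open>convex_on\<close> is restricted to real-valued functions. Taking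
  \<open>t\<close> in the open interval makes the condition independent of the value of \<open>0 * \<infinity>\<close>.\<close>

definition convex_functional :: "('a::real_vector \<Rightarrow> ereal) \<Rightarrow> bool" where
  "convex_functional J \<longleftrightarrow>
     (\<forall>x y. \<forall>t::real. 0 < t \<and> t < 1 \<longrightarrow>
        J ((1 - t) *\<^sub>R x + t *\<^sub>R y) \<le> ereal (1 - t) * J x + ereal t * J y)"

definition trilinear ::
  "('a::real_vector \<Rightarrow> 'b::real_vector \<Rightarrow> 'c::real_vector \<Rightarrow> 'd::real_vector) \<Rightarrow> bool" where
  "trilinear a \<longleftrightarrow>
     (\<forall>u v. linear (\<lambda>w. a w u v)) \<and>
     (\<forall>w v. linear (\<lambda>u. a w u v)) \<and>
     (\<forall>w u. linear (\<lambda>v. a w u v))"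

end

theory Submission
  imports Defs
begin

text \<open>
  Completing the square and the parallelogram law show that minimizing sequences of
  \<open>c / 2 * \<parallel>u\<parallel>\<^sup>2 - L u + J u\<close> are Cauchy, so a minimizer exists; it solves the variational
  inequality for the form \<open>c * (u \<bullet> v)\<close>. With \<open>J = 0\<close> this is the Riesz representation
  theorem, and for a coercive form \<open>a0\<close> and large \<open>c\<close> the map sending \<open>w\<close> to the minimizer for
  \<open>L = c * (w \<bullet> _) - a0 w + f\<close> is a contraction, whose fixed point solves the variational
  inequality for \<open>a0\<close>. Freezing the trilinear term, \<open>w \<mapsto> v\<close> with
  \<open>a0 v (u - v) + a1 w w (u - v) + J u - J v \<ge> f (u - v)\<close> is a contraction of the ball of
  radius \<open>M\<close> with factor \<open>2 * K * M / \<alpha>\<close>. The number \<open>M\<close> is the smaller root of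
  \<open>K * M\<^sup>2 - \<alpha> * M + \<parallel>f\<parallel> = 0\<close>.

  An extended-valued \<open>J\<close> is treated as a real function \<open>j\<close> on its effective domain \<open>D\<close>;
  lower semicontinuity then becomes closedness of the epigraph.
\<close>

section \<open>Minimization of a quadratic plus a convex function, and Riesz representation\<close>

text \<open>Divide by \<open>s\<close> and let \<open>s\<close> tend to 0 from the right. This turns
  comparisons of a minimizer with nearby points of a segment into a first-order condition;
  \<open>B\<close> carries the second-order remainder.\<close>

lemma nonneg_of_first_order:
  fixes A B :: real
  assumes "\<And>s. 0 < s \<Longrightarrow> s < 1 \<Longrightarrow> 0 \<le> s * A + s\<^sup>2 * B"
  shows "0 \<le> A"
proof (rule tendsto_lowerbound)
  show "((\<lambda>s. A + s * B) \<longlongrightarrow> A) (at_right 0)"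
    by (auto intro!: tendsto_eq_intros)
  have "0 \<le> A + s * B" if "0 < s" "s < 1" for s
  proof -
    have "0 \<le> s * (A + s * B)"
      using assms[OF that] by (simp add: algebra_simps power2_eq_square)
    with that show ?thesis by (simp add: zero_le_mult_iff)
  qed
  then show "\<forall>\<^sub>F s in at_right 0. 0 \<le> A + s * B"
    by (auto simp: eventually_at_right_field intro: exI[of _ 1])
qed simp

text \<open>The quadratic term gives both a lower bound and uniform convexity, so a minimizing
  sequence converges in norm and no weak compactness enters. The closed epigraph then transfers the
  limit of the values to the limit point.\<close>

lemma quadratic_minimizer_exists:
  fixes j :: "'a::{real_inner, complete_space} \<Rightarrow> real"
  assumes D: "D \<noteq> {}" and cvx: "convex_on D j" and clo: "closed (epigraph D j)"
    and nonneg: "\<And>x. x \<in> D \<Longrightarrow> 0 \<le> j x"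
    and L: "bounded_linear L" and c: "c > 0"
  obtains p where "p \<in> D"
    "\<And>u. u \<in> D \<Longrightarrow> c / 2 * (norm p)\<^sup>2 - L p + j p \<le> c / 2 * (norm u)\<^sup>2 - L u + j u"
proof -
  interpret L: bounded_linear L by fact
  define \<phi> where "\<phi> u = c / 2 * (norm u)\<^sup>2 - L u + j u" for u
  obtain B where B: "\<And>x. norm (L x) \<le> norm x * B"
    using L.bounded by blast
  have low: "- (B\<^sup>2 / (2 * c)) \<le> \<phi> u" if "u \<in> D" for u
  proof -
    \<comment> \<open>The lower bound is the minimum of \<open>c / 2 * r\<^sup>2 - B * r\<close>
      over real \<open>r\<close>, found by completing the square.\<close>
    have "0 \<le> (c * norm u - B)\<^sup>2 / (2 * c)" using c by simp
    also have "\<dots> = c / 2 * (norm u)\<^sup>2 - norm u * B + B\<^sup>2 / (2 * c)"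
      using c by (simp add: field_simps power2_eq_square)
    finally show ?thesis
      using nonneg[OF that] B[of u] unfolding \<phi>_def by simp
  qed
  define m where "m = Inf (\<phi> ` D)"
  have bdd: "bdd_below (\<phi> ` D)"
    using low by (auto intro!: bdd_belowI2)
  have m_le: "m \<le> \<phi> u" if "u \<in> D" for u
    unfolding m_def using bdd that by (intro cInf_lower) auto
  have "\<exists>x\<in>D. \<phi> x < m + 1 / real (Suc n)" for n
    using cInf_lessD[of "\<phi> ` D" "m + 1 / real (Suc n)"] D unfolding m_def by auto
  then obtain x where x: "\<And>n. x n \<in> D" "\<And>n. \<phi> (x n) < m + 1 / real (Suc n)"
    by metis
  \<comment> \<open>The value at the midpoint is at least \<open>m\<close>, while the parallelogram
    law makes it smaller than the mean of the two values by at least the left-hand side. Hence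
    near-minimizers are close to each other.\<close>
  have mid: "c / 8 * (norm (y - z))\<^sup>2 \<le> (\<phi> y + \<phi> z) / 2 - m" if "y \<in> D" "z \<in> D" for y z
  proof -
    let ?h = "(1/2) *\<^sub>R y + (1/2) *\<^sub>R z"
    have "?h \<in> D"
      using convex_on_imp_convex[OF cvx] that by (auto simp: convex_def)
    moreover have "j ?h \<le> (j y + j z) / 2"
      using convex_onD[OF cvx, of "1/2" y z] that by simp
    moreover have "L ?h = (L y + L z) / 2"
      by (simp add: L.add L.scale)
    moreover have "c / 2 * (norm ?h)\<^sup>2 =
        (c / 2 * (norm y)\<^sup>2 + c / 2 * (norm z)\<^sup>2) / 2 - c / 8 * (norm (y - z))\<^sup>2"
      by (simp add: power2_norm_eq_inner field_simps inner_simps inner_commute)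
    ultimately have "\<phi> ?h \<le> (\<phi> y + \<phi> z) / 2 - c / 8 * (norm (y - z))\<^sup>2"
      unfolding \<phi>_def by (simp add: add_divide_distrib diff_divide_distrib)
    with m_le[OF \<open>?h \<in> D\<close>] show ?thesis by linarith
  qed
  have "Cauchy x"
  proof (rule metric_CauchyI)
    fix e :: real assume "e > 0"
    then obtain N where N: "1 / real (Suc N) < c / 8 * e\<^sup>2"
      using nat_approx_posE[of "c / 8 * e\<^sup>2"] c by auto
    have "dist (x k) (x l) < e" if "k \<ge> N" "l \<ge> N" for k l
    proof -
      have "1 / real (Suc k) \<le> 1 / real (Suc N)" "1 / real (Suc l) \<le> 1 / real (Suc N)"
        using that by (auto intro!: divide_left_mono)
      then have "\<phi> (x k) < m + 1 / real (Suc N)" "\<phi> (x l) < m + 1 / real (Suc N)"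
        using x(2)[of k] x(2)[of l] by linarith+
      then have "(\<phi> (x k) + \<phi> (x l)) / 2 - m < 1 / real (Suc N)"
        by (simp add: field_simps del: of_nat_Suc)
      with mid[OF x(1) x(1), of k l] N have "c / 8 * (norm (x k - x l))\<^sup>2 < c / 8 * e\<^sup>2"
        by (meson le_less_trans less_trans)
      then have "(norm (x k - x l))\<^sup>2 < e\<^sup>2"
        using c by simp
      then show ?thesis
        using \<open>e > 0\<close> by (simp add: dist_norm power2_less_imp_less)
    qed
    then show "\<exists>N. \<forall>k\<ge>N. \<forall>l\<ge>N. dist (x k) (x l) < e" by blast
  qed
  then obtain p where p: "x \<longlonglongrightarrow> p"
    using Cauchy_convergent convergent_def by blast
  have "(\<lambda>n. \<phi> (x n)) \<longlonglongrightarrow> m"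
  proof (rule tendsto_sandwich[OF _ _ tendsto_const])
    show "(\<lambda>n. m + 1 / real (Suc n)) \<longlonglongrightarrow> m"
      using tendsto_add[OF tendsto_const LIMSEQ_inverse_real_of_nat, of m]
      by (simp add: inverse_eq_divide)
    show "\<forall>\<^sub>F n in sequentially. m \<le> \<phi> (x n)"
      using m_le x(1) by simp
    show "\<forall>\<^sub>F n in sequentially. \<phi> (x n) \<le> m + 1 / real (Suc n)"
      using x(2) by (simp add: less_imp_le)
  qed
  \<comment> \<open>Removing the continuous part of \<open>\<phi>\<close> leaves
    \<open>j (x n)\<close>, so the values of \<open>j\<close> converge although \<open>j\<close>
    need not be continuous. The graph points then converge to a point of the closed epigraph, which
    says \<open>\<phi> p \<le> m\<close>.\<close>
  then have "(\<lambda>n. \<phi> (x n) - (c / 2 * (norm (x n))\<^sup>2 - L (x n))) \<longlonglongrightarrow>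
      m - (c / 2 * (norm p)\<^sup>2 - L p)"
    by (intro tendsto_intros p L.tendsto)
  then have "(\<lambda>n. (x n, j (x n))) \<longlonglongrightarrow> (p, m - (c / 2 * (norm p)\<^sup>2 - L p))"
    by (intro tendsto_Pair p) (simp add: \<phi>_def)
  then have "(p, m - (c / 2 * (norm p)\<^sup>2 - L p)) \<in> epigraph D j"
    using clo x(1) by (elim closed_sequentially[rotated 2]) (auto simp: epigraph_def)
  then have "p \<in> D" "\<phi> p \<le> m"
    by (auto simp: epigraph_def \<phi>_def)
  with m_le that show ?thesis
    unfolding \<phi>_def by (meson order_trans)
qed

text \<open>Compare the minimizer \<open>p\<close> with the points of the segment from
  \<open>p\<close> to \<open>u\<close>: convexity bounds \<open>j\<close> there by an affine
  function of \<open>s\<close>, and the first-order condition at \<open>s = 0\<close> is the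
  claim.\<close>

lemma inner_variational_inequality:
  fixes j :: "'a::{real_inner, complete_space} \<Rightarrow> real"
  assumes D: "D \<noteq> {}" and cvx: "convex_on D j" and clo: "closed (epigraph D j)"
    and nonneg: "\<And>x. x \<in> D \<Longrightarrow> 0 \<le> j x"
    and L: "bounded_linear L" and c: "c > 0"
  obtains p where "p \<in> D" "\<And>u. u \<in> D \<Longrightarrow> L (u - p) \<le> c * (p \<bullet> (u - p)) + j u - j p"
proof -
  interpret L: bounded_linear L by fact
  obtain p where p: "p \<in> D"
    "\<And>u. u \<in> D \<Longrightarrow> c / 2 * (norm p)\<^sup>2 - L p + j p \<le> c / 2 * (norm u)\<^sup>2 - L u + j u"
    using quadratic_minimizer_exists[OF assms] by blast
  have "0 \<le> c * (p \<bullet> (u - p)) + j u - j p - L (u - p)" if u: "u \<in> D" for u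
  proof (rule nonneg_of_first_order)
    fix s :: real assume s: "0 < s" "s < 1"
    let ?h = "(1 - s) *\<^sub>R p + s *\<^sub>R u"
    have "?h \<in> D"
      using convex_on_imp_convex[OF cvx] p(1) u s by (auto simp: convex_def)
    note p(2)[OF this]
    moreover have "j ?h \<le> (1 - s) * j p + s * j u"
      using convex_onD[OF cvx, of s p u] p(1) u s by simp
    moreover have "L ?h = L p + s * L (u - p)"
      by (simp add: L.add L.scale L.diff algebra_simps)
    moreover have "c / 2 * (norm ?h)\<^sup>2 =
        c / 2 * (norm p)\<^sup>2 + s * (c * (p \<bullet> (u - p))) + s\<^sup>2 * (c / 2 * (norm (u - p))\<^sup>2)"
      unfolding power2_norm_eq_inner
      by (simp add: algebra_simps inner_commute power2_eq_square)
    ultimately show "0 \<le> s * (c * (p \<bullet> (u - p)) + j u - j p - L (u - p))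
        + s\<^sup>2 * (c / 2 * (norm (u - p))\<^sup>2)"
      unfolding distrib_left right_diff_distrib left_diff_distrib by linarith
  qed
  then have "L (u - p) \<le> c * (p \<bullet> (u - p)) + j u - j p" if "u \<in> D" for u
    using that by fastforce
  with p(1) that show ?thesis by blast
qed

text \<open>For \<open>j = 0\<close> on the whole space both \<open>u\<close> and \<open>- u\<close>
  are admissible directions, so the variational inequality becomes an equality.\<close>

lemma riesz_representation:
  fixes L :: "'a::{real_inner, complete_space} \<Rightarrow> real"
  assumes "bounded_linear L"
  obtains y where "\<And>u. L u = y \<bullet> u"
proof -
  have "epigraph UNIV (\<lambda>_::'a. 0::real) = UNIV \<times> {0..}"
    by (auto simp: epigraph_def)
  then have clo: "closed (epigraph UNIV (\<lambda>_::'a. 0::real))"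
    by (simp add: closed_Times)
  obtain y where y: "\<And>u. L (u - y) \<le> y \<bullet> (u - y)"
    using inner_variational_inequality[OF _ _ clo _ assms, of 1]
    by (auto simp: convex_on_def)
  have "L u = y \<bullet> u" for u
    using y[of "y + u"] y[of "y - u"] bounded_linear.axioms(1)[OF assms]
    by (simp add: linear_neg)
  with that show ?thesis by blast
qed

section \<open>Variational inequalities for coercive bilinear forms\<close>

text \<open>As \<open>a\<close> may be nonsymmetric, the inequality is in general not the optimality
  condition of a functional. It is reached through inner-product problems whose auxiliary terms
  cancel at a fixed point.\<close>

lemma lions_stampacchia:
  fixes j :: "'a::{real_inner, complete_space} \<Rightarrow> real" and a :: "'a \<Rightarrow> 'a \<Rightarrow> real"
  assumes D: "D \<noteq> {}" and cvx: "convex_on D j" and clo: "closed (epigraph D j)"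
    and nonneg: "\<And>x. x \<in> D \<Longrightarrow> 0 \<le> j x"
    and bil: "bilinear a" and bnd: "\<And>u v. \<bar>a u v\<bar> \<le> K * norm u * norm v"
    and \<alpha>: "\<alpha> > 0" and coercive: "\<And>u. \<alpha> * (norm u)\<^sup>2 \<le> a u u"
    and f: "bounded_linear f"
  obtains v where "v \<in> D" "\<And>u. u \<in> D \<Longrightarrow> f (u - v) \<le> a v (u - v) + j u - j v"
proof -
  \<comment> \<open>\<open>C\<close> is a positive bound for \<open>a\<close> with
    \<open>\<alpha> \<le> C\<close>. The choice of \<open>c\<close> minimizes the factor
    \<open>1 - 2 * \<alpha> / c + (C / c)\<^sup>2\<close>, and the minimum is
    \<open>q\<^sup>2\<close>.\<close>
  define C where "C = \<bar>K\<bar> + \<alpha>"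
  define c where "c = C\<^sup>2 / \<alpha>"
  define q where "q = sqrt (1 - (\<alpha> / C)\<^sup>2)"
  have C: "C > 0" "\<alpha> \<le> C" and c: "c > 0"
    using \<alpha> by (auto simp: C_def c_def add_nonneg_pos)
  have "(\<alpha> / C)\<^sup>2 \<le> 1" "0 < (\<alpha> / C)\<^sup>2"
    using C \<alpha> by (auto simp: power_le_one_iff)
  then have q: "0 \<le> q" "q < 1" and q2: "q\<^sup>2 = 1 - (\<alpha> / C)\<^sup>2"
    by (auto simp: q_def)
  have bnd': "\<bar>a u v\<bar> \<le> norm v * (C * norm u)" for u v
  proof -
    have "K * (norm u * norm v) \<le> C * (norm u * norm v)"
      using \<alpha> by (intro mult_right_mono) (auto simp: C_def)
    with bnd[of u v] show ?thesis by (simp add: ac_simps)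
  qed
  have bl: "bounded_linear (a u)" for u
    using bil bnd'[of u] unfolding bilinear_def
    by (intro bounded_linear_intro[where K = "C * norm u"])
      (auto simp: linear_add linear_scale)
  \<comment> \<open>With \<open>y\<close> the Riesz representative of \<open>a d\<close>, the left
    side is \<open>(c *\<^sub>R d - y) \<bullet> e\<close>. Expanding the square of the norm and
    using coercivity and boundedness gives the factor \<open>c * q\<close>.\<close>
  have key: "c * (d \<bullet> e) - a d e \<le> c * q * norm d * norm e" for d e
  proof -
    obtain y where y: "\<And>u. a d u = y \<bullet> u"
      using riesz_representation[OF bl[of d]] by blast
    have "norm y \<le> C * norm d"
    proof (cases "y = 0")
      case False
      have "norm y * norm y \<le> norm y * (C * norm d)"
        using bnd'[of d y] unfolding y by (simp add: dot_square_norm power2_eq_square)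
      with False show ?thesis by simp
    qed (use C in simp)
    then have "(norm y)\<^sup>2 \<le> C\<^sup>2 * (norm d)\<^sup>2"
      using power_mono[of "norm y" "C * norm d" 2] by (simp add: power_mult_distrib)
    moreover have "\<alpha> * (norm d)\<^sup>2 \<le> y \<bullet> d"
      using coercive[of d] by (simp add: y)
    then have "2 * c * (\<alpha> * (norm d)\<^sup>2) \<le> 2 * c * (y \<bullet> d)"
      using c by simp
    moreover have "c * \<alpha> = C\<^sup>2"
      using \<alpha> by (simp add: c_def)
    then have "2 * c * (\<alpha> * (norm d)\<^sup>2) = 2 * C\<^sup>2 * (norm d)\<^sup>2"
      by simp
    moreover have "(norm (c *\<^sub>R d - y))\<^sup>2 = c\<^sup>2 * (norm d)\<^sup>2 - 2 * c * (y \<bullet> d) + (norm y)\<^sup>2"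
      unfolding power2_norm_eq_inner
      by (simp add: algebra_simps inner_commute power2_eq_square)
    ultimately have "(norm (c *\<^sub>R d - y))\<^sup>2 \<le> (c\<^sup>2 - C\<^sup>2) * (norm d)\<^sup>2"
      unfolding left_diff_distrib by linarith
    also have "c\<^sup>2 - C\<^sup>2 = c\<^sup>2 * q\<^sup>2"
      using \<alpha> C unfolding q2 c_def by (simp add: field_simps power2_eq_square)
    finally have "(norm (c *\<^sub>R d - y))\<^sup>2 \<le> (c * q * norm d)\<^sup>2"
      by (simp add: power_mult_distrib)
    then have "norm (c *\<^sub>R d - y) \<le> c * q * norm d"
      by (rule power2_le_imp_le) (use c q in simp)
    then have "norm (c *\<^sub>R d - y) * norm e \<le> c * q * norm d * norm e"
      by (rule mult_right_mono) simp
    with norm_cauchy_schwarz[of "c *\<^sub>R d - y" e] show ?thesis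
      by (simp add: y inner_diff_left)
  qed
  \<comment> \<open>If \<open>S v v\<close>, the two inner-product terms cancel and the inequality
    for \<open>a\<close> remains.\<close>
  define S where "S w p \<longleftrightarrow> p \<in> D \<and> (\<forall>u\<in>D. c * (w \<bullet> (u - p)) - a w (u - p) + f (u - p)
      \<le> c * (p \<bullet> (u - p)) + j u - j p)" for w p
  have "\<exists>p. S w p" for w
  proof -
    have "bounded_linear (\<lambda>u. c * (w \<bullet> u) - a w u + f u)"
      by (intro bounded_linear_add bounded_linear_sub bl f
          bounded_linear_const_mult bounded_linear_inner_right)
    then obtain p where "p \<in> D"
      "\<And>u. u \<in> D \<Longrightarrow> c * (w \<bullet> (u - p)) - a w (u - p) + f (u - p)
        \<le> c * (p \<bullet> (u - p)) + j u - j p"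
      using inner_variational_inequality[OF D cvx clo nonneg _ c] by blast
    then have "S w p"
      by (simp add: S_def)
    then show ?thesis ..
  qed
  then obtain T where "\<And>w. S w (T w)"
    by metis
  then have T: "T w \<in> D" and
    T_le: "u \<in> D \<Longrightarrow> c * (w \<bullet> (u - T w)) - a w (u - T w) + f (u - T w)
      \<le> c * (T w \<bullet> (u - T w)) + j u - j (T w)" for w u
    unfolding S_def by auto
  have "dist (T w) (T z) \<le> q * dist w z" for w z
  proof -
    \<comment> \<open>Test the problem of \<open>w\<close> with \<open>T z\<close> and that of
      \<open>z\<close> with \<open>T w\<close>, and add: the terms in \<open>j\<close> and
      \<open>f\<close> cancel, and \<open>key\<close> bounds what is left.\<close>
    let ?d = "w - z" and ?e = "T w - T z"
    have "f (T z - T w) = - f ?e" "a w (T z - T w) = - a w ?e"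
      using linear_neg[OF bounded_linear.linear[OF f], of ?e]
        linear_neg[OF bounded_linear.linear[OF bl], of w ?e] by auto
    moreover have "a ?d ?e = a w ?e - a z ?e"
      using bil by (simp add: bilinear_lsub)
    ultimately have "c * (?e \<bullet> ?e) \<le> c * (?d \<bullet> ?e) - a ?d ?e"
      using T_le[OF T, of w z] T_le[OF T, of z w] by (simp add: algebra_simps)
    also note key
    finally have "norm ?e * (c * norm ?e) \<le> norm ?e * (c * (q * norm ?d))"
      by (simp add: dot_square_norm power2_eq_square ac_simps)
    then show ?thesis
      using c q by (cases "T w = T z") (auto simp: dist_norm)
  qed
  then obtain v where "T v = v"
    using banach_fix_type[OF q] by metis
  with T[of v] T_le[of _ v] show ?thesis
    by (intro that[of v]) (auto simp: algebra_simps)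
qed

section \<open>The trilinear term as a perturbation on a ball\<close>

lemma trilinear_variational_inequality:
  fixes j :: "'a::{real_inner, complete_space} \<Rightarrow> real" and a0 :: "'a \<Rightarrow> 'a \<Rightarrow> real"
    and a1 :: "'a \<Rightarrow> 'a \<Rightarrow> 'a \<Rightarrow> real"
  assumes D: "0 \<in> D" and cvx: "convex_on D j" and clo: "closed (epigraph D j)"
    and nonneg: "\<And>x. x \<in> D \<Longrightarrow> 0 \<le> j x" and j0: "j 0 = 0"
    and bil: "bilinear a0" and bnd0: "\<And>u v. \<bar>a0 u v\<bar> \<le> K * norm u * norm v"
    and \<alpha>: "\<alpha> > 0" and coercive: "\<And>u. \<alpha> * (norm u)\<^sup>2 \<le> a0 u u"
    and tri: "trilinear a1"
    and bnd1: "\<And>w u v. \<bar>a1 w u v\<bar> \<le> K * norm w * norm u * norm v"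
    and f: "bounded_linear f" and F: "\<And>u. \<bar>f u\<bar> \<le> F * norm u"
    and K: "K \<ge> 0" and M: "M \<ge> 0" "F + K * M\<^sup>2 \<le> \<alpha> * M" "2 * K * M < \<alpha>"
  shows "\<exists>!v. v \<in> cball 0 M \<and> v \<in> D \<and>
    (\<forall>u\<in>D. f (u - v) \<le> a0 v (u - v) + a1 v v (u - v) + j u - j v)"
proof -
  define S where "S w v \<longleftrightarrow> v \<in> D \<and>
    (\<forall>u\<in>D. f (u - v) \<le> a0 v (u - v) + a1 w w (u - v) + j u - j v)" for w v
  have lin0: "linear (a0 w)" and linf: "linear f" for w
    using bil f by (auto simp: bilinear_def bounded_linear.linear)
  have lin1: "linear (a1 w u)" "linear (\<lambda>z. a1 w z u)" "linear (\<lambda>z. a1 z w u)" for w u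
    using tri by (auto simp: trilinear_def)
  \<comment> \<open>Stated for arbitrary solutions \<open>p\<close> and \<open>q\<close>, so that it
    yields both the contraction and the final uniqueness.\<close>
  have stable: "norm (p - q) \<le> (2 * K * M / \<alpha>) * norm (w - z)"
    if "S w p" "S z q" "w \<in> cball 0 M" "z \<in> cball 0 M" for w z p q
  proof -
    let ?d = "w - z" and ?e = "p - q"
    have neg: "q - p = - ?e" by simp
    have "f (q - p) \<le> a0 p (q - p) + a1 w w (q - p) + j q - j p"
      "f (p - q) \<le> a0 q (p - q) + a1 z z (p - q) + j p - j q"
      using that by (auto simp: S_def)
    then have "a0 p ?e - a0 q ?e \<le> a1 z z ?e - a1 w w ?e"
      unfolding neg linear_neg[OF lin0] linear_neg[OF lin1(1)] linear_neg[OF linf]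
      by linarith
    moreover have "a0 p ?e - a0 q ?e = a0 ?e ?e"
      using bil by (simp add: bilinear_lsub)
    \<comment> \<open>Changing one argument at a time gives two terms, each of size at most
      \<open>K * M * norm ?d * norm ?e\<close>; hence the factor 2.\<close>
    moreover have "a1 w w ?e - a1 z z ?e = a1 w ?d ?e + a1 ?d z ?e"
      using linear_diff[OF lin1(2)] linear_diff[OF lin1(3)] by simp
    moreover have "K * norm w * norm ?d * norm ?e \<le> K * M * norm ?d * norm ?e"
      "K * norm ?d * norm z * norm ?e \<le> K * norm ?d * M * norm ?e"
      using that K by (auto intro!: mult_right_mono mult_left_mono)
    ultimately have "\<alpha> * (norm ?e)\<^sup>2 \<le> 2 * (K * M * norm ?d * norm ?e)"
      using bnd1[of w ?d ?e] bnd1[of ?d z ?e] coercive[of ?e] by (simp add: ac_simps)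
    then have "norm ?e * (\<alpha> * norm ?e) \<le> norm ?e * (2 * K * M * norm ?d)"
      by (simp add: power2_eq_square ac_simps)
    then have "\<alpha> * norm ?e \<le> 2 * K * M * norm ?d"
      using K M(1) by (cases "p = q") auto
    then show ?thesis
      using \<alpha> by (simp add: field_simps)
  qed
  have solvable: "\<exists>v. S w v" for w
  proof -
    have "bounded_linear (a1 w w)"
      using bnd1[of w w] lin1(1)[of w w]
      by (intro bounded_linear_intro[where K = "K * norm w * norm w"])
        (auto simp: linear_add linear_scale ac_simps)
    \<comment> \<open>For fixed \<open>w\<close> the trilinear term is a bounded functional and
      moves to the right-hand side.\<close>
    then have "bounded_linear (\<lambda>u. f u - a1 w w u)"
      by (intro bounded_linear_sub f)
    then obtain v where "v \<in> D"
      "\<And>u. u \<in> D \<Longrightarrow> f (u - v) - a1 w w (u - v) \<le> a0 v (u - v) + j u - j v"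
      using lions_stampacchia[OF _ cvx clo nonneg bil bnd0 \<alpha> coercive] D by blast
    then have "S w v"
      unfolding S_def by (fastforce simp: algebra_simps)
    then show ?thesis ..
  qed
  have in_ball: "v \<in> cball 0 M" if "S w v" and w: "w \<in> cball 0 M" for w v
  proof -
    \<comment> \<open>Energy estimate: test with \<open>u = 0\<close>, where \<open>j\<close>
      vanishes, and drop \<open>j v \<ge> 0\<close>.\<close>
    have "v \<in> D" "f (0 - v) \<le> a0 v (0 - v) + a1 w w (0 - v) + j 0 - j v"
      using that D by (auto simp: S_def)
    then have "a0 v v \<le> f v - a1 w w v"
      using nonneg[of v] j0 linear_neg[OF lin0, of v v] linear_neg[OF lin1(1), of w w v]
        linear_neg[OF linf, of v] by simp
    moreover have "K * norm w * norm w * norm v \<le> K * M * M * norm v"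
      using w K M(1) by (intro mult_right_mono mult_mono) auto
    ultimately have "\<alpha> * (norm v)\<^sup>2 \<le> F * norm v + K * M * M * norm v"
      using F[of v] bnd1[of w w v] coercive[of v] by linarith
    then have "norm v * (\<alpha> * norm v) \<le> norm v * (F + K * M\<^sup>2)"
      by (simp add: power2_eq_square algebra_simps)
    then have "v = 0 \<or> \<alpha> * norm v \<le> F + K * M\<^sup>2"
      by (auto simp: mult_le_cancel_left)
    then have "v = 0 \<or> \<alpha> * norm v \<le> \<alpha> * M"
      using M(2) by auto
    then show ?thesis
      using \<alpha> M(1) by auto
  qed
  obtain T where T: "\<And>w. S w (T w)"
    using solvable by metis
  have q: "0 \<le> 2 * K * M / \<alpha>" "2 * K * M / \<alpha> < 1"
    using K M \<alpha> by auto
  have "\<exists>!v. v \<in> cball 0 M \<and> T v = v"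
    using stable[OF T T] in_ball[OF T] M(1)
    by (intro Banach_fix[OF _ _ q]) (auto simp: complete_eq_closed dist_norm)
  then obtain v where v: "v \<in> cball 0 M" "S v v"
    using T by metis
  \<comment> \<open>\<open>T\<close> merely selects a solution, so uniqueness of its fixed point
    does not at once cover every \<open>u\<close> with \<open>S u u\<close>; \<open>stable\<close>
    does.\<close>
  have "u = v" if "u \<in> cball 0 M" "S u u" for u
  proof (rule ccontr)
    assume "u \<noteq> v"
    then have "(2 * K * M / \<alpha>) * norm (u - v) < norm (u - v)"
      using q(2) mult_strict_right_mono[of "2 * K * M / \<alpha>" 1 "norm (u - v)"] by simp
    with stable[OF that(2) v(2) that(1) v(1)] show False by linarith
  qed
  with v have "\<exists>!v. v \<in> cball 0 M \<and> S v v" by blast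
  then show ?thesis
    unfolding S_def .
qed

section \<open>From extended-valued functionals to real functions on the effective domain\<close>

text \<open>If a limit \<open>(p, t)\<close> left the epigraph, some real \<open>s\<close> would lie
  strictly between \<open>t\<close> and \<open>J p\<close>. Semicontinuity keeps \<open>J\<close>
  above \<open>s\<close> near \<open>p\<close>, while the heights of the sequence fall below
  \<open>s\<close>.\<close>

lemma closed_epigraph_of_lower_semicontinuous:
  fixes J :: "'a::metric_space \<Rightarrow> ereal"
  assumes lsc: "lower_semicontinuous J" and nonneg: "\<And>u. 0 \<le> J u"
  shows "closed (epigraph {u. J u < \<infinity>} (\<lambda>u. real_of_ereal (J u)))"
proof -
  have epi: "(u, t) \<in> epigraph {u. J u < \<infinity>} (\<lambda>u. real_of_ereal (J u)) \<longleftrightarrow> J u \<le> ereal t" for u t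
    using nonneg[of u] by (cases "J u") (auto simp: epigraph_def)
  show ?thesis
    unfolding closed_sequential_limits
  proof (intro allI impI, elim conjE)
    fix X l
    assume X: "\<forall>n. X n \<in> epigraph {u. J u < \<infinity>} (\<lambda>u. real_of_ereal (J u))"
      and lim: "X \<longlonglongrightarrow> l"
    obtain p t where l: "l = (p, t)" by fastforce
    have lims: "(\<lambda>n. fst (X n)) \<longlonglongrightarrow> p" "(\<lambda>n. snd (X n)) \<longlonglongrightarrow> t"
      using tendsto_fst[OF lim] tendsto_snd[OF lim] by (auto simp: l)
    have le: "J (fst (X n)) \<le> ereal (snd (X n))" for n
      using X epi[of "fst (X n)" "snd (X n)"] by auto
    have "J p \<le> ereal t"
    proof (rule ccontr)
      assume "\<not> J p \<le> ereal t"
      then obtain s where s: "ereal t < ereal s" "ereal s < J p"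
        by (meson ereal_dense2 not_le)
      then have "ereal s < Liminf (at p) J"
        using lsc by (meson less_le_trans lower_semicontinuous_def)
      then have "\<forall>\<^sub>F x in at p. ereal s < J x"
        by (rule less_LiminfD)
      \<comment> \<open>The filter \<open>at p\<close> omits \<open>p\<close> itself, which the
        sequence may visit; there \<open>s(2)\<close> supplies the bound.\<close>
      with s(2) have "\<forall>\<^sub>F x in nhds p. ereal s < J x"
        by (auto simp: eventually_at_filter elim: eventually_mono)
      then have above: "\<forall>\<^sub>F n in sequentially. ereal s < J (fst (X n))"
        using lims(1) by (rule eventually_compose_filterlim)
      have below: "\<forall>\<^sub>F n in sequentially. snd (X n) < s"
        using order_tendstoD(2)[OF lims(2)] s(1) by simp
      have False if "ereal s < J (fst (X n))" "snd (X n) < s" for n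
        using less_le_trans[OF that(1) le] that(2) by simp
      with above below have "\<forall>\<^sub>F n in sequentially. False"
        by (rule eventually_elim2)
      then show False by simp
    qed
    then show "l \<in> epigraph {u. J u < \<infinity>} (\<lambda>u. real_of_ereal (J u))"
      unfolding l epi .
  qed
qed

lemma convex_on_of_convex_functional:
  fixes J :: "'a::real_vector \<Rightarrow> ereal"
  assumes cvx: "convex_functional J" and nonneg: "\<And>u. 0 \<le> J u"
  shows "convex_on {u. J u < \<infinity>} (\<lambda>u. real_of_ereal (J u))"
proof -
  have fin: "J u = ereal (real_of_ereal (J u))" if "J u < \<infinity>" for u
    using that nonneg[of u] by (cases "J u") auto
  have le: "J ((1 - t) *\<^sub>R x + t *\<^sub>R y)
      \<le> ereal ((1 - t) * real_of_ereal (J x) + t * real_of_ereal (J y))"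
    if fins: "J x < \<infinity>" "J y < \<infinity>" and "0 < t" "t < 1" for x y t
  proof -
    obtain r s where "J x = ereal r" "J y = ereal s"
      using fin[OF fins(1)] fin[OF fins(2)] by blast
    moreover have "J ((1 - t) *\<^sub>R x + t *\<^sub>R y) \<le> ereal (1 - t) * J x + ereal t * J y"
      using cvx that by (simp add: convex_functional_def)
    ultimately show ?thesis by simp
  qed
  have lt: "J ((1 - t) *\<^sub>R x + t *\<^sub>R y) < \<infinity>"
    if "J x < \<infinity>" "J y < \<infinity>" "0 < t" "t < 1" for x y t
    by (rule le_less_trans[OF le[OF that]]) simp
  show ?thesis
  proof (rule convex_onI)
    fix t :: real and x y
    assume t: "0 < t" "t < 1" and xy: "x \<in> {u. J u < \<infinity>}" "y \<in> {u. J u < \<infinity>}"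
    show "real_of_ereal (J ((1 - t) *\<^sub>R x + t *\<^sub>R y))
        \<le> (1 - t) * real_of_ereal (J x) + t * real_of_ereal (J y)"
      using le[of x y t] fin[OF lt[of x y t]] t xy by (metis ereal_less_eq(3) mem_Collect_eq)
  next
    show "convex {u. J u < \<infinity>}"
      unfolding convex_alt
    proof (intro ballI allI impI)
      fix x y and t :: real
      assume "x \<in> {u. J u < \<infinity>}" "y \<in> {u. J u < \<infinity>}" "0 \<le> t \<and> t \<le> 1"
      then show "(1 - t) *\<^sub>R x + t *\<^sub>R y \<in> {u. J u < \<infinity>}"
        \<comment> \<open>The endpoints are separate because \<open>convex_functional\<close> speaks
          only of \<open>0 < t < 1\<close>.\<close>
        using lt[of x y t] by (cases "t = 0 \<or> t = 1") auto
    qed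
  qed
qed

section \<open>The smallness threshold and the radius\<close>

theorem theorem4p2:
  fixes J :: "'a::{real_inner, complete_space} \<Rightarrow> ereal"
    and a0 :: "'a \<Rightarrow> 'a \<Rightarrow> real"
    and a1 :: "'a \<Rightarrow> 'a \<Rightarrow> 'a \<Rightarrow> real"
    and K \<alpha> :: real
  assumes "separable_space (euclidean :: 'a topology)"
    and "\<And>u. 0 \<le> J u"
    and "proper_functional J"
    and "lower_semicontinuous J"
    and "convex_functional J"
    and "J 0 = 0"
    and "bilinear a0"
    and "\<And>u v. \<bar>a0 u v\<bar> \<le> K * norm u * norm v"
    and "\<alpha> > 0"
    and "\<And>u. a0 u u \<ge> \<alpha> * (norm u)\<^sup>2"
    and "trilinear a1"
    and "\<And>w u v. \<bar>a1 w u v\<bar> \<le> K * norm w * norm u * norm v"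
  shows "\<exists>\<eta>>0. \<forall>f :: 'a \<Rightarrow>\<^sub>L real. norm f \<le> \<eta> \<longrightarrow>
           (\<exists>M\<ge>0. M = 1 / \<alpha> * (norm f + K * M\<^sup>2) \<and> 2 * K * M / \<alpha> < 1 \<and>
              (\<exists>!v. v \<in> cball 0 M \<and> J v < \<infinity> \<and>
                 (\<forall>u. ereal (a0 v (u - v) + a1 v v (u - v)) + J u - J v
                        \<ge> ereal (blinfun_apply f (u - v)))))"
proof (cases "K > 0")
  \<comment> \<open>The formula for \<open>M\<close> used below divides by \<open>K\<close>. For
    \<open>K \<le> 0\<close> boundedness and coercivity force the space to be trivial, so
    \<open>M = 0\<close> and \<open>v = 0\<close> serve with any threshold, here 1.\<close>
  case False
  have zero: "u = 0" for u :: 'a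
  proof -
    have "\<alpha> * (norm u)\<^sup>2 \<le> K * (norm u)\<^sup>2"
      using assms(8)[of u u] assms(10)[of u] by (simp add: power2_eq_square)
    moreover have "K * (norm u)\<^sup>2 \<le> 0"
      using False by (simp add: mult_nonpos_nonneg)
    ultimately have "\<alpha> * (norm u)\<^sup>2 \<le> 0" by linarith
    with \<open>\<alpha> > 0\<close> show ?thesis by (simp add: mult_le_0_iff)
  qed
  have f0: "norm f = 0" for f :: "'a \<Rightarrow>\<^sub>L real"
    using zero by (metis blinfun.zero_right blinfun_eqI norm_zero zero_blinfun.rep_eq)
  have J0: "J u = 0" for u
    using zero[of u] assms(6) by simp
  have "a0 u v = 0" "a1 w u v = 0" "blinfun_apply f u = 0" for u v w and f :: "'a \<Rightarrow>\<^sub>L real"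
    using assms(8)[of u v] assms(12)[of w u v] norm_blinfun[of f u] zero[of u] by auto
  then have "\<exists>!v. v \<in> cball 0 0 \<and> J v < \<infinity> \<and>
      (\<forall>u. ereal (a0 v (u - v) + a1 v v (u - v)) + J u - J v \<ge> ereal (blinfun_apply f (u - v)))"
    for f :: "'a \<Rightarrow>\<^sub>L real"
    by (intro ex1I[of _ 0]) (simp_all add: J0)
  then show ?thesis
    by (intro exI[of _ "1::real"] conjI allI impI exI[of _ "0::real"]) (simp_all only: f0, simp_all)
next
  case K: True
  define D where "D = {u. J u < \<infinity>}"
  define j where "j u = real_of_ereal (J u)" for u
  have J_D: "J u = ereal (j u)" if "u \<in> D" for u
    using that assms(2)[of u] by (cases "J u") (auto simp: D_def j_def)
  have J_not_D: "J u = \<infinity>" if "u \<notin> D" for u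
    using that by (auto simp: D_def)
  \<comment> \<open>For \<open>v\<close> in \<open>D\<close>, a test point outside \<open>D\<close>
    makes the left side infinite, so only \<open>u\<close> in \<open>D\<close> imposes a
    condition.\<close>
  have translate: "v \<in> cball 0 M \<and> J v < \<infinity> \<and>
      (\<forall>u. ereal (a0 v (u - v) + a1 v v (u - v)) + J u - J v \<ge> ereal (blinfun_apply f (u - v)))
    \<longleftrightarrow> v \<in> cball 0 M \<and> v \<in> D \<and>
      (\<forall>u\<in>D. f (u - v) \<le> a0 v (u - v) + a1 v v (u - v) + j u - j v)"
    for v M and f :: "'a \<Rightarrow>\<^sub>L real"
  proof (cases "v \<in> D")
    case True
    have "ereal (a0 v (u - v) + a1 v v (u - v)) + J u - J v \<ge> ereal (f (u - v)) \<longleftrightarrow>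
        (u \<in> D \<longrightarrow> f (u - v) \<le> a0 v (u - v) + a1 v v (u - v) + j u - j v)" for u
      using J_D[OF True] J_D[of u] J_not_D[of u] by (cases "u \<in> D") auto
    with True show ?thesis by (auto simp: D_def)
  qed (auto simp: D_def)
  have cvx: "convex_on D j" and clo: "closed (epigraph D j)"
    using convex_on_of_convex_functional[OF assms(5,2)]
      closed_epigraph_of_lower_semicontinuous[OF assms(4,2)]
    by (auto simp: D_def j_def[abs_def])
  have D0: "0 \<in> D" and j0: "j 0 = 0" and jpos: "\<And>u. 0 \<le> j u"
    using assms(2,6) by (auto simp: D_def j_def real_of_ereal_pos)
  show ?thesis
  \<comment> \<open>Half of the critical value \<open>\<alpha>\<^sup>2 / (4 * K)\<close>, so that
    the discriminant stays strictly positive; this makes \<open>2 * K * M = \<alpha> - s\<close>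
    strictly less than \<open>\<alpha>\<close>.\<close>
  proof (rule exI[of _ "\<alpha>\<^sup>2 / (8 * K)"], intro conjI allI impI)
    show "0 < \<alpha>\<^sup>2 / (8 * K)"
      using K \<open>\<alpha> > 0\<close> by simp
  next
    fix f :: "'a \<Rightarrow>\<^sub>L real"
    assume f: "norm f \<le> \<alpha>\<^sup>2 / (8 * K)"
    define s where "s = sqrt (\<alpha>\<^sup>2 - 4 * K * norm f)"
    define M where "M = (\<alpha> - s) / (2 * K)"
    have "8 * (K * norm f) \<le> \<alpha>\<^sup>2"
      using f K by (simp add: field_simps)
    moreover have "0 < \<alpha>\<^sup>2" using \<open>\<alpha> > 0\<close> by simp
    ultimately have pos: "0 < \<alpha>\<^sup>2 - 4 * K * norm f" by linarith
    then have s: "0 < s" "s\<^sup>2 = \<alpha>\<^sup>2 - 4 * K * norm f"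
      by (auto simp: s_def)
    have "s\<^sup>2 \<le> \<alpha>\<^sup>2" using K by (simp add: s(2))
    then have "s \<le> \<alpha>"
      by (rule power2_le_imp_le) (use \<open>\<alpha> > 0\<close> in simp)
    then have M0: "0 \<le> M"
      using K by (simp add: M_def)
    have KM: "2 * K * M = \<alpha> - s"
      using K by (simp add: M_def)
    have "4 * K * (K * M\<^sup>2) = (\<alpha> - s)\<^sup>2"
      unfolding KM[symmetric] by (simp add: power2_eq_square)
    also have "\<dots> = 2 * \<alpha> * (\<alpha> - s) - 4 * K * norm f"
      using s(2) by (simp add: power2_eq_square algebra_simps)
    also have "\<dots> = 4 * K * (\<alpha> * M - norm f)"
      unfolding KM[symmetric] by (simp add: algebra_simps)
    finally have root: "norm f + K * M\<^sup>2 = \<alpha> * M"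
      using K by simp
    have small: "2 * K * M < \<alpha>"
      using KM s(1) by simp
    have "\<exists>!v. v \<in> cball 0 M \<and> v \<in> D \<and>
        (\<forall>u\<in>D. f (u - v) \<le> a0 v (u - v) + a1 v v (u - v) + j u - j v)"
      using norm_blinfun[of f] root K
      by (intro trilinear_variational_inequality[OF D0 cvx clo jpos j0 assms(7-12)
            blinfun.bounded_linear_right[of f] _ _ M0 _ small, of "norm f"]) auto
    moreover have "M = 1 / \<alpha> * (norm f + K * M\<^sup>2)" "2 * K * M / \<alpha> < 1"
      using root small \<open>\<alpha> > 0\<close> by auto
    ultimately show "\<exists>M\<ge>0. M = 1 / \<alpha> * (norm f + K * M\<^sup>2) \<and> 2 * K * M / \<alpha> < 1 \<and>
        (\<exists>!v. v \<in> cball 0 M \<and> J v < \<infinity> \<and>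
          (\<forall>u. ereal (a0 v (u - v) + a1 v v (u - v)) + J u - J v
            \<ge> ereal (blinfun_apply f (u - v))))"
      using M0 unfolding translate by blast
  qed
qed

end
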